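(* Let $n$ be even and let $X_1,\dots,X_n$ be real random variables with nonatomic distributions satisfying Assumption A of the context with constant $\beta>0$. Let $\delta\in(0,1)$ be such that $128\log\frac6\delta\le n$, set $\alpha=\sqrt{2\log\frac6\delta}$, and assume that $\alpha\sqrt n$ is an integer. Then, with probability at least $1-\delta$, the median interval $I_\alpha=[X_{(n/2-\alpha\sqrt n)},X_{(n/2+\alpha\sqrt n)}]$ satisfies both $\mu\in I_\alpha$ and \[ |I_\alpha|\le 8e\sqrt2\,\max\left\{\log\frac3\delta,\ \log(n+1)\right\}\beta^{-1}\max_{1\le j\le 8\alpha\sqrt n}\frac{8\alpha\sqrt n+1-j}{\sum_{i=j}^n\sigma_i^{-1}} . \]
   Context: Assumption A. $X_1,\dots,X_n$ are independent real random variables, $0<\sigma_1\le\cdots\le\sigma_n$, and: (i) $\mathbb E X_i=\mu$ for all $i$; (ii) $X_i-\mu$ and $\mu-X_i$ have the same distribution for each $i$; (iii) for some $\beta>0$ and all $t>0$, $\mathbb P\{|(X_i-\mu)/\sigma_i|\ge t\}\le\exp(-\beta t)$ for each $i$. $X_{(1)}\le\cdots\le X_{(n)}$ denote the order statistics of $X_1,\dots,X_n$, and $|I|$ denotes the length of an interval $I$. *)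

theory Defs
  imports "HOL-Probability.Probability"
begin

(* The equivalence with the absence of point masses, for finite Borel measures on the line,
   is lemma nonatomic_iff_no_point_mass below. *)
definition nonatomic :: "'a measure \<Rightarrow> bool" where
  "nonatomic N \<longleftrightarrow>
     (\<forall>A\<in>sets N. 0 < emeasure N A \<longrightarrow>
        (\<exists>B\<in>sets N. B \<subseteq> A \<and> 0 < emeasure N B \<and> emeasure N B < emeasure N A))"

lemma (in finite_borel_measure) nonatomic_iff_no_point_mass:
  "nonatomic M \<longleftrightarrow> (\<forall>x. emeasure M {x} = 0)"
proof
  assume na: "nonatomic M"
  show "\<forall>x. emeasure M {x} = 0"
  proof (intro allI, rule ccontr)
    fix x
    assume "emeasure M {x} \<noteq> 0"
    then have pos: "0 < emeasure M {x}"
      by (simp add: zero_less_iff_neq_zero)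
    have "{x} \<in> sets M"
      by (simp add: M_is_borel)
    with na pos obtain B where "B \<subseteq> {x}" "0 < emeasure M B" "emeasure M B < emeasure M {x}"
      unfolding nonatomic_def by blast
    then show False
      by (cases "B = {}") (auto simp: subset_singleton_iff)
  qed
next
  assume np: "\<forall>x. emeasure M {x} = 0"
  show "nonatomic M"
    unfolding nonatomic_def
  proof (intro ballI impI)
    fix A
    assume A: "A \<in> sets M" and pos: "0 < emeasure M A"
    have Aborel: "A \<in> sets borel"
      using A M_is_borel by simp
    define F where "F x = measure M (A \<inter> {..x})" for x
    define R where "R = density M (indicator A)"
    have eR: "emeasure R S = emeasure M (A \<inter> S)" if "S \<in> sets borel" for S
      using that A unfolding R_def by (intro emeasure_restricted) (auto simp: M_is_borel)
    have mR: "measure R S = measure M (A \<inter> S)" if "S \<in> sets borel" for S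
      using eR[OF that] by (simp add: measure_def)
    have sR: "sets R = sets borel" "space R = UNIV"
      unfolding R_def using M_is_borel borel_UNIV by auto
    interpret R: finite_borel_measure R
    proof (intro finite_borel_measure.intro finite_borel_measure_axioms.intro finite_measureI)
      show "emeasure R (space R) \<noteq> \<infinity>"
        using eR[of UNIV] sR by simp
    qed (fact sR)
    have cont: "isCont (cdf R) x" for x
    proof -
      have "measure M (A \<inter> {x}) \<le> measure M {x}"
        by (intro finite_measure_mono) (auto simp: M_is_borel)
      moreover have "measure M {x} = 0"
        using np by (simp add: measure_def)
      ultimately show ?thesis
        using R.isCont_cdf[of x] mR[of "{x}"] measure_nonneg[of M "A \<inter> {x}"] by simp
    qed
    define m where "m = measure M A"
    have m: "0 < m" "measure R (space R) = m"
      using pos mR[of UNIV] sR unfolding m_def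
      by (auto simp: emeasure_eq_measure)
    have "\<forall>\<^sub>F x in at_bot. cdf R x < m / 2"
      using R.cdf_lim_at_bot m(1) by (intro order_tendstoD(2)[of _ 0]) auto
    then obtain a where a: "cdf R a < m / 2"
      by (auto simp: eventually_at_bot_linorder)
    have "\<forall>\<^sub>F x in at_top. m / 2 < cdf R x"
      using R.cdf_lim_at_top m by (intro order_tendstoD(1)[of _ m]) auto
    then obtain b where b: "m / 2 < cdf R b"
      by (auto simp: eventually_at_top_linorder)
    have "a \<le> b"
      using a b R.cdf_nondecreasing[of b a] by linarith
    then obtain x where x: "cdf R x = m / 2"
      using IVT[of "cdf R" a "m / 2" b] a b cont by auto
    have half: "measure M (A \<inter> {..x}) = m / 2"
      using x mR[of "{..x}"] by (simp add: cdf_def)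
    show "\<exists>B\<in>sets M. B \<subseteq> A \<and> 0 < emeasure M B \<and> emeasure M B < emeasure M A"
      using half m A M_is_borel
      by (intro bexI[of _ "A \<inter> {..x}"])
        (auto simp: emeasure_eq_measure m_def[symmetric] ennreal_less_iff)
  qed
qed

definition assumption_A ::
    "'a measure \<Rightarrow> nat \<Rightarrow> (nat \<Rightarrow> 'a \<Rightarrow> real) \<Rightarrow> (nat \<Rightarrow> real) \<Rightarrow> real \<Rightarrow> real \<Rightarrow> bool" where
  "assumption_A M n X \<sigma> \<mu> \<beta> \<longleftrightarrow>
     prob_space.indep_vars M (\<lambda>_. borel) X {1..n} \<and>
     (\<forall>i\<in>{1..n}. 0 < \<sigma> i) \<and> mono_on {1..n} \<sigma> \<and>
     (\<forall>i\<in>{1..n}. integrable M (X i) \<and> integral\<^sup>L M (X i) = \<mu>) \<and>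
     (\<forall>i\<in>{1..n}. distr M borel (\<lambda>\<omega>. X i \<omega> - \<mu>) = distr M borel (\<lambda>\<omega>. \<mu> - X i \<omega>)) \<and>
     0 < \<beta> \<and>
     (\<forall>i\<in>{1..n}. \<forall>t>0.
        measure M {\<omega> \<in> space M. \<bar>(X i \<omega> - \<mu>) / \<sigma> i\<bar> \<ge> t} \<le> exp (- \<beta> * t))"

(* Ranks are 1-based; meaningful for 1 \<le> k \<le> n. *)
definition order_stat :: "nat \<Rightarrow> (nat \<Rightarrow> 'a \<Rightarrow> real) \<Rightarrow> nat \<Rightarrow> 'a \<Rightarrow> real" where
  "order_stat n X k \<omega> = sort (map (\<lambda>i. X i \<omega>) [1..<Suc n]) ! (k - 1)"

(* Here m is the integer \<alpha> * sqrt n; meaningful for even n and m < n div 2. *)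
definition median_interval :: "nat \<Rightarrow> (nat \<Rightarrow> 'a \<Rightarrow> real) \<Rightarrow> nat \<Rightarrow> 'a \<Rightarrow> real set" where
  "median_interval n X m \<omega> = {order_stat n X (n div 2 - m) \<omega> .. order_stat n X (n div 2 + m) \<omega>}"

end

theory Submission
  imports Defs
begin

text \<open>
  Let \<open>s\<close> be half of the claimed bound on the length. The event fails only if one of the four counts
  \<open>#{i. X i < \<mu>}\<close>, \<open>#{i. X i > \<mu>}\<close>, \<open>#{i. X i < \<mu> - s}\<close>, \<open>#{i. X i > \<mu> + s}\<close> is too large: at
  least \<open>n/2 + m\<close> for the first two, at least \<open>n/2 - m\<close> for the last two. By symmetry the first two
  have mean at most \<open>n/2\<close>. The last two have mean at most \<open>n/2 - 2m\<close>, because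
  \<open>P(|X i - \<mu>| \<le> s) \<ge> 1 - exp (- \<beta> s / \<sigma> i) \<ge> min 1 (\<beta> s / \<sigma> i) / 2\<close>, and the choice of \<open>s\<close> makes
  these lower bounds add up to at least \<open>4m\<close>. So each count exceeds its mean by at least \<open>m\<close>, which
  by Hoeffding's inequality has probability at most \<open>exp (-2 m\<^sup>2 / n) = (\<delta> / 6) ^ 4\<close>.
\<close>

text \<open>In a sorted list the entries satisfying a downward closed \<open>P\<close> form an
  initial segment, whose length is the number of such entries.\<close>

lemma sorted_nth_downward_closed_iff:
  fixes xs :: "'a::linorder list"
  assumes "sorted xs" "k < length xs" and down: "\<And>x y. P y \<Longrightarrow> x \<le> y \<Longrightarrow> P x"
  shows "P (xs ! k) \<longleftrightarrow> k < length (filter P xs)"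
proof -
  let ?S = "{i. i < length xs \<and> P (xs ! i)}"
  have len: "length (filter P xs) = card ?S"
    by (rule length_filter_conv_card)
  show ?thesis
  proof
    assume "P (xs ! k)"
    then have "{..k} \<subseteq> ?S"
      using assms by (auto simp: sorted_iff_nth_mono intro: down)
    then have "card {..k} \<le> card ?S"
      by (intro card_mono) auto
    then show "k < length (filter P xs)"
      using len by simp
  next
    assume less: "k < length (filter P xs)"
    show "P (xs ! k)"
    proof (rule ccontr)
      assume "\<not> P (xs ! k)"
      then have "?S \<subseteq> {..<k}"
        using assms by (auto simp: sorted_iff_nth_mono not_le[symmetric] intro: down)
      then have "card ?S \<le> card {..<k}"
        by (intro card_mono) auto
      then show False
        using len less by simp
    qed
  qed
qed

text \<open>Translates bounds on order statistics into bounds on counts. A general \<open>P\<close>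
  serves both \<open>y \<le> x\<close> and \<open>y < x\<close>.\<close>

lemma order_stat_downward_closed_iff:
  assumes "1 \<le> k" "k \<le> n" and down: "\<And>x y::real. P y \<Longrightarrow> x \<le> y \<Longrightarrow> P x"
  shows "P (order_stat n X k \<omega>) \<longleftrightarrow> k \<le> card {i\<in>{1..n}. P (X i \<omega>)}"
proof -
  let ?xs = "map (\<lambda>i. X i \<omega>) [1..<Suc n]"
  have "P (sort ?xs ! (k - 1)) \<longleftrightarrow> k - 1 < length (filter P (sort ?xs))"
    using assms by (intro sorted_nth_downward_closed_iff) auto
  also have "length (filter P (sort ?xs)) = length (filter (\<lambda>i. P (X i \<omega>)) [1..<Suc n])"
    by (simp add: filter_sort o_def del: upt_Suc)
  also have "\<dots> = card (set (filter (\<lambda>i. P (X i \<omega>)) [1..<Suc n]))"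
    by (intro distinct_card[symmetric]) simp
  also have "set (filter (\<lambda>i. P (X i \<omega>)) [1..<Suc n]) = {i\<in>{1..n}. P (X i \<omega>)}"
    by auto
  finally show ?thesis
    using assms(1) unfolding order_stat_def by linarith
qed

lemma borel_measurable_order_stat:
  assumes "1 \<le> k" "k \<le> n" and [measurable]: "\<And>i. i \<in> {1..n} \<Longrightarrow> X i \<in> borel_measurable M"
  shows "order_stat n X k \<in> borel_measurable M"
proof (subst borel_measurable_iff_le, intro allI)
  fix a
  have "{\<omega>\<in>space M. order_stat n X k \<omega> \<le> a}
      = {\<omega>\<in>space M. k \<le> card {i\<in>{1..n}. X i \<omega> \<le> a}}"
    using assms(1,2) by (subst order_stat_downward_closed_iff) auto
  also have "\<dots> \<in> sets M"
    by measurable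
  finally show "{\<omega>\<in>space M. order_stat n X k \<omega> \<le> a} \<in> sets M" .
qed

text \<open>The count is a sum of independent indicators with values in [0, 1], so Hoeffding's
  inequality applies.\<close>

lemma (in prob_space) prob_card_ge_le_exp:
  fixes a \<epsilon> :: real
  assumes indep: "indep_vars (\<lambda>_. N) X I" and I: "finite I" "I \<noteq> {}" and B: "B \<in> sets N"
    and \<epsilon>: "0 \<le> \<epsilon>" and a: "(\<Sum>i\<in>I. prob {\<omega>\<in>space M. X i \<omega> \<in> B}) \<le> a"
  shows "prob {\<omega>\<in>space M. a + \<epsilon> \<le> card {i\<in>I. X i \<omega> \<in> B}} \<le> exp (-2 * \<epsilon>\<^sup>2 / card I)"
proof -
  let ?Y = "\<lambda>i \<omega>. indicator B (X i \<omega>) :: real"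
  have rv: "X i \<in> measurable M N" if "i \<in> I" for i
    using indep that unfolding indep_vars_def by blast
  have indep_Y: "indep_vars (\<lambda>_. borel) ?Y I"
    using indep by (rule indep_vars_compose2) (use B in auto)
  have E: "expectation (?Y i) = prob {\<omega>\<in>space M. X i \<omega> \<in> B}" if "i \<in> I" for i
  proof -
    have "expectation (?Y i) = expectation (indicator {\<omega>\<in>space M. X i \<omega> \<in> B})"
      by (intro Bochner_Integration.integral_cong) (auto simp: indicator_def)
    also have "\<dots> = prob {\<omega>\<in>space M. X i \<omega> \<in> B}"
      by (simp add: Int_def conj_commute)
    finally show ?thesis .
  qed
  interpret Hoeffding_ineq M I ?Y "\<lambda>_. 0" "\<lambda>_. 1" "\<Sum>i\<in>I. expectation (?Y i)"
    by unfold_locales (use I indep_Y in \<open>auto simp: indicator_def\<close>)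
  have sum_Y: "(\<Sum>i\<in>I. ?Y i \<omega>) = card {i\<in>I. X i \<omega> \<in> B}" for \<omega>
    using I by (simp add: indicator_def sum.If_cases Int_def)
  have meas_Y: "(\<lambda>\<omega>. \<Sum>i\<in>I. ?Y i \<omega>) \<in> borel_measurable M"
    using indep_Y unfolding indep_vars_def by (intro borel_measurable_sum) auto
  \<comment> \<open>The mean of the sum is at most \<open>a\<close>, so putting it in the place of
    \<open>a\<close> enlarges the event.\<close>
  have "prob {\<omega>\<in>space M. a + \<epsilon> \<le> (\<Sum>i\<in>I. ?Y i \<omega>)}
      \<le> prob {\<omega>\<in>space M. (\<Sum>i\<in>I. expectation (?Y i)) + \<epsilon> \<le> (\<Sum>i\<in>I. ?Y i \<omega>)}"
    using a E meas_Y by (intro finite_measure_mono) auto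
  also have "\<dots> \<le> exp (-2 * \<epsilon>\<^sup>2 / card I)"
    using Hoeffding_ineq_ge[OF \<epsilon>] I by (simp add: card_gt_0_iff)
  finally show ?thesis
    unfolding sum_Y .
qed

text \<open>With \<open>y = min 1 x\<close>, combines \<open>1 + y \<le> exp x\<close> with
  \<open>1 / (1 + y) \<le> 1 - y / 2\<close>, valid on [0, 1].\<close>

lemma one_minus_exp_ge_half_min:
  fixes x :: real
  assumes "0 \<le> x"
  shows "min 1 x / 2 \<le> 1 - exp (- x)"
proof -
  let ?y = "min 1 x"
  have "1 + ?y \<le> exp x"
    using exp_ge_add_one_self[of x] by linarith
  then have "exp (- x) \<le> inverse (1 + ?y)"
    using assms unfolding exp_minus by (intro le_imp_inverse_le) auto
  also have "\<dots> \<le> 1 - ?y / 2"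
  proof -
    \<comment> \<open>Clearing denominators reduces the claim to this inequality.\<close>
    have "?y * ?y \<le> ?y * 1"
      using assms by (intro mult_left_mono) auto
    then show ?thesis
      using assms by (simp add: field_simps)
  qed
  finally show ?thesis
    by simp
qed

text \<open>The indices are split at the first \<open>j\<close> with \<open>s * u j < 1\<close>.\<close>

lemma half_le_sum_one_minus_exp:
  fixes u :: "nat \<Rightarrow> real"
  assumes "k \<le> n" and u: "\<And>i. i \<in> {1..n} \<Longrightarrow> 0 \<le> u i" "antimono_on {1..n} u" and "0 \<le> s"
    and s: "\<And>j. j \<in> {1..k} \<Longrightarrow> real k + 1 - real j \<le> s * (\<Sum>i=j..n. u i)"
  shows "real k / 2 \<le> (\<Sum>i=1..n. 1 - exp (- (s * u i)))"
proof -
  have su: "0 \<le> s * u i" if "i \<in> {1..n}" for i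
    using u(1)[OF that] \<open>0 \<le> s\<close> by simp
  have "real k \<le> (\<Sum>i=1..n. min 1 (s * u i))"
  proof (cases "\<forall>i\<in>{1..k}. 1 \<le> s * u i")
    case True
    then have "real k = (\<Sum>i=1..k. min 1 (s * u i))"
      by simp
    also have "\<dots> \<le> (\<Sum>i=1..n. min 1 (s * u i))"
      using \<open>k \<le> n\<close> su by (intro sum_mono2) auto
    finally show ?thesis .
  next
    case False
    let ?P = "\<lambda>i. i \<in> {1..k} \<and> s * u i < 1"
    define j where "j = (LEAST i. ?P i)"
    have "\<exists>i. ?P i"
      using False by (simp add: not_le Bex_def)
    then have "?P j"
      unfolding j_def by (rule LeastI_ex)
    then have j: "j \<in> {1..k}" "s * u j < 1"
      by blast+
    have before: "1 \<le> s * u i" if "i \<in> {1..<j}" for i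
    proof -
      have "\<not> ?P i"
        using that unfolding j_def by (intro not_less_Least) simp
      then show ?thesis
        using that j(1) by auto
    qed
    have after: "s * u i < 1" if "i \<in> {j..n}" for i
    proof -
      have "s * u i \<le> s * u j"
        using that j \<open>k \<le> n\<close> \<open>0 \<le> s\<close> by (intro mult_left_mono monotone_onD[OF u(2)]) auto
      with j(2) show ?thesis by simp
    qed
    \<comment> \<open>The hypothesis at \<open>j\<close>, with k split as (j - 1) + (k + 1 - j).
      Each of the j - 1 earlier minima is 1; from \<open>j\<close> on, monotonicity of
      \<open>u\<close> makes the minimum \<open>s * u i\<close>.\<close>
    have "real k \<le> real (j - 1) + s * (\<Sum>i=j..n. u i)"
      using s[OF j(1)] j(1) by (simp add: of_nat_diff)
    also have "\<dots> = (\<Sum>i=1..<j. min 1 (s * u i)) + (\<Sum>i=j..n. min 1 (s * u i))"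
      using before after by (simp add: sum_distrib_left min_absorb2 less_imp_le)
    also have "\<dots> = (\<Sum>i\<in>{1..<j} \<union> {j..n}. min 1 (s * u i))"
      by (intro sum.union_disjoint[symmetric]) auto
    also have "{1..<j} \<union> {j..n} = {1..n}"
      using j \<open>k \<le> n\<close> by auto
    finally show ?thesis .
  qed
  then have "real k / 2 \<le> (\<Sum>i=1..n. min 1 (s * u i) / 2)"
    by (simp add: sum_divide_distrib[symmetric])
  also have "\<dots> \<le> (\<Sum>i=1..n. 1 - exp (- (s * u i)))"
    using su by (intro sum_mono one_minus_exp_ge_half_min) auto
  finally show ?thesis .
qed

text \<open>Reflection about \<open>\<mu>\<close> exchanges the two tails, which are disjoint
  because \<open>0 \<le> s\<close>. At \<open>s = 0\<close> each side of \<open>\<mu>\<close> thus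
  has mass at most 1/2.\<close>

lemma (in prob_space) symmetric_tails:
  fixes X :: "'a \<Rightarrow> real"
  assumes [measurable]: "X \<in> borel_measurable M"
    and sym: "distr M borel (\<lambda>\<omega>. X \<omega> - \<mu>) = distr M borel (\<lambda>\<omega>. \<mu> - X \<omega>)" and "0 \<le> s"
  shows "prob {\<omega>\<in>space M. X \<omega> < \<mu> - s} = prob {\<omega>\<in>space M. s < \<bar>X \<omega> - \<mu>\<bar>} / 2"
    and "prob {\<omega>\<in>space M. X \<omega> > \<mu> + s} = prob {\<omega>\<in>space M. s < \<bar>X \<omega> - \<mu>\<bar>} / 2"
proof -
  have "prob {\<omega>\<in>space M. X \<omega> > \<mu> + s} = measure (distr M borel (\<lambda>\<omega>. X \<omega> - \<mu>)) {s<..}"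
    by (subst measure_distr) (auto intro!: arg_cong[where f=prob])
  also have "\<dots> = prob {\<omega>\<in>space M. X \<omega> < \<mu> - s}"
    unfolding sym by (subst measure_distr) (auto intro!: arg_cong[where f=prob])
  finally have eq: "prob {\<omega>\<in>space M. X \<omega> > \<mu> + s} = prob {\<omega>\<in>space M. X \<omega> < \<mu> - s}" .
  have "{\<omega>\<in>space M. s < \<bar>X \<omega> - \<mu>\<bar>} = {\<omega>\<in>space M. X \<omega> < \<mu> - s} \<union> {\<omega>\<in>space M. X \<omega> > \<mu> + s}"
    by auto
  also have "prob \<dots> = prob {\<omega>\<in>space M. X \<omega> < \<mu> - s} + prob {\<omega>\<in>space M. X \<omega> > \<mu> + s}"
    using \<open>0 \<le> s\<close> by (intro finite_measure_Union) auto
  finally show "prob {\<omega>\<in>space M. X \<omega> < \<mu> - s} = prob {\<omega>\<in>space M. s < \<bar>X \<omega> - \<mu>\<bar>} / 2"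
    and "prob {\<omega>\<in>space M. X \<omega> > \<mu> + s} = prob {\<omega>\<in>space M. s < \<bar>X \<omega> - \<mu>\<bar>} / 2"
    using eq by auto
qed

theorem proposition1:
  fixes M :: "'a measure" and X :: "nat \<Rightarrow> 'a \<Rightarrow> real" and \<sigma> :: "nat \<Rightarrow> real"
    and \<mu> \<beta> \<delta> \<alpha> :: real and n m :: nat
  assumes "prob_space M"
    and "even n"
    and "assumption_A M n X \<sigma> \<mu> \<beta>"
    and "\<forall>i\<in>{1..n}. nonatomic (distr M borel (X i))"
    and "0 < \<delta>" and "\<delta> < 1"
    and "128 * ln (6 / \<delta>) \<le> real n"
    and "\<alpha> = sqrt (2 * ln (6 / \<delta>))"
    and "\<alpha> * sqrt (real n) = real m"
  shows "measure M {\<omega> \<in> space M.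
           \<mu> \<in> median_interval n X m \<omega> \<and>
           measure lborel (median_interval n X m \<omega>) \<le>
             8 * exp 1 * sqrt 2 * max (ln (3 / \<delta>)) (ln (real n + 1)) * inverse \<beta> *
             (MAX j\<in>{1..8 * m}. (8 * real m + 1 - real j) / (\<Sum>i=j..n. inverse (\<sigma> i)))}
         \<ge> 1 - \<delta>"
proof -
  interpret prob_space M by fact

  \<comment> \<open>Sizes of \<open>m\<close> and \<open>n\<close>\<close>
  define L where "L = ln (6 / \<delta>)"
  have "1 < 6 / \<delta>"
    using \<open>0 < \<delta>\<close> \<open>\<delta> < 1\<close> by simp
  then have L: "0 < L"
    unfolding L_def by (rule ln_gt_zero)
  have nL: "128 * L \<le> real n"
    using assms(7) unfolding L_def .
  then have n: "0 < n"
    using L by (cases n) auto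
  have m2: "(real m)\<^sup>2 = 2 * L * real n"
    using L n unfolding assms(9)[symmetric] assms(8) L_def[symmetric]
    by (simp add: power_mult_distrib)
  have m: "0 < m"
    using m2 L n by (cases m) auto
  \<comment> \<open>Here the constant 128 enters: 64 m^2 = 128 L n is at most n^2. Hence all indices
    in the maximum are at most \<open>n\<close>.\<close>
  have "(real (8 * m))\<^sup>2 \<le> (real n)\<^sup>2"
    using mult_right_mono[OF nL, of "real n"] m2 by (simp add: power2_eq_square)
  then have mn: "8 * m \<le> n"
    using power2_le_imp_le[of "real (8 * m)" "real n"] by linarith
  obtain h where h: "n = 2 * h"
    using \<open>even n\<close> by blast

  have A: "indep_vars (\<lambda>_. borel) X {1..n}" "\<And>i. i \<in> {1..n} \<Longrightarrow> 0 < \<sigma> i"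
    "mono_on {1..n} \<sigma>"
    "\<And>i. i \<in> {1..n} \<Longrightarrow> distr M borel (\<lambda>\<omega>. X i \<omega> - \<mu>) = distr M borel (\<lambda>\<omega>. \<mu> - X i \<omega>)"
    "0 < \<beta>"
    "\<And>i t. i \<in> {1..n} \<Longrightarrow> 0 < t \<Longrightarrow>
      prob {\<omega>\<in>space M. t \<le> \<bar>(X i \<omega> - \<mu>) / \<sigma> i\<bar>} \<le> exp (- \<beta> * t)"
    using assms(3) unfolding assumption_A_def by auto
  have rv [measurable]: "X i \<in> borel_measurable M" if "i \<in> {1..n}" for i
    using A(1) that unfolding indep_vars_def by blast

  \<comment> \<open>The half-length \<open>s\<close>\<close>
  let ?f = "\<lambda>j. (8 * real m + 1 - real j) / (\<Sum>i=j..n. inverse (\<sigma> i))"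
  define a where "a = (MAX j\<in>{1..8 * m}. ?f j)"
  define c where "c = 4 * exp 1 * sqrt 2 * max (ln (3 / \<delta>)) (ln (real n + 1))"
  define s where "s = c * inverse \<beta> * a"
  have sum_pos: "0 < (\<Sum>i=j..n. inverse (\<sigma> i))" if "j \<in> {1..8 * m}" for j
    using that mn A(2) by (intro sum_pos) auto
  have le_a: "?f j \<le> a" if "j \<in> {1..8 * m}" for j
    unfolding a_def using that by (intro Max_ge) auto
  have a: "0 < a"
  proof -
    have "0 < ?f 1"
      using m sum_pos[of 1] by (intro divide_pos_pos) auto
    also have "\<dots> \<le> a"
      using m by (intro le_a) auto
    finally show ?thesis .
  qed
  have c: "1 \<le> c"
  proof -
    \<comment> \<open>Since \<open>n\<close> is at least 8, the logarithm of \<open>n + 1\<close> is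
      at least 1, and so is every factor of \<open>c\<close>.\<close>
    have "exp 1 \<le> real n + 1"
      using exp_le mn m by linarith
    then have "1 \<le> ln (real n + 1)"
      by (subst ln_ge_iff) auto
    then have "1 * 1 * 1 * 1 \<le> c"
      unfolding c_def by (intro mult_mono) auto
    then show ?thesis by simp
  qed
  have s: "0 < s"
    unfolding s_def using a c \<open>0 < \<beta>\<close> by simp

  \<comment> \<open>Total mass within distance \<open>s\<close> of the center\<close>
  have mean: "4 * real m \<le> (\<Sum>i=1..n. 1 - prob {\<omega>\<in>space M. s < \<bar>X i \<omega> - \<mu>\<bar>})"
  proof -
    \<comment> \<open>The lemma is used with \<open>k = 8 * m\<close>, weights
      \<open>inverse (\<sigma> i)\<close> and scale \<open>\<beta> * s\<close>. Its hypothesis on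
      \<open>j\<close> holds because \<open>a\<close> is a maximum over these
      \<open>j\<close>.\<close>
    have "real (8 * m) / 2 \<le> (\<Sum>i=1..n. 1 - exp (- (\<beta> * s * inverse (\<sigma> i))))"
    proof (rule half_le_sum_one_minus_exp)
      show "antimono_on {1..n} (\<lambda>i. inverse (\<sigma> i))"
        using A(2) by (intro monotone_onI le_imp_inverse_le monotone_onD[OF A(3)]) auto
    next
      fix j assume j: "j \<in> {1..8 * m}"
      have "real (8 * m) + 1 - real j \<le> a * (\<Sum>i=j..n. inverse (\<sigma> i))"
        using le_a[OF j] sum_pos[OF j] by (simp add: pos_divide_le_eq)
      \<comment> \<open>\<open>\<beta> * s\<close> equals \<open>c * a\<close>, and
        \<open>1 \<le> c\<close>.\<close>
      also have "a \<le> \<beta> * s"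
        using c a \<open>0 < \<beta>\<close> by (simp add: s_def field_simps)
      finally show "real (8 * m) + 1 - real j \<le> \<beta> * s * (\<Sum>i=j..n. inverse (\<sigma> i))"
        using sum_pos[OF j] by (simp add: mult_right_mono less_imp_le)
    qed (use mn A s in \<open>auto simp: less_imp_le\<close>)
    also have "\<dots> \<le> (\<Sum>i=1..n. 1 - prob {\<omega>\<in>space M. s < \<bar>X i \<omega> - \<mu>\<bar>})"
    proof (intro sum_mono diff_left_mono)
      fix i assume i: "i \<in> {1..n}"
      note [measurable] = rv[OF i]
      have "prob {\<omega>\<in>space M. s < \<bar>X i \<omega> - \<mu>\<bar>}
          \<le> prob {\<omega>\<in>space M. s / \<sigma> i \<le> \<bar>(X i \<omega> - \<mu>) / \<sigma> i\<bar>}"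
        using A(2)[OF i] by (intro finite_measure_mono) (auto simp: divide_right_mono less_imp_le)
      also have "\<dots> \<le> exp (- (\<beta> * s * inverse (\<sigma> i)))"
        using A(6)[OF i, of "s / \<sigma> i"] A(2)[OF i] s by (simp add: divide_inverse mult.assoc)
      finally show "prob {\<omega>\<in>space M. s < \<bar>X i \<omega> - \<mu>\<bar>} \<le> exp (- (\<beta> * s * inverse (\<sigma> i)))" .
    qed
    finally show ?thesis by simp
  qed

  \<comment> \<open>Probability that a count is too large\<close>
  define bad where "bad B b = {\<omega>\<in>space M. b \<le> real (card {i\<in>{1..n}. X i \<omega> \<in> B})}" for B b
  have bad_meas: "bad B b \<in> events" if [measurable]: "B \<in> sets borel" for B b
    unfolding bad_def by measurable
  have bad: "prob (bad B (r + real m)) \<le> \<delta> / 4"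
    if "B \<in> sets borel" "(\<Sum>i=1..n. prob {\<omega>\<in>space M. X i \<omega> \<in> B}) \<le> r" for B r
  proof -
    have "prob (bad B (r + real m)) \<le> exp (-2 * (real m)\<^sup>2 / real (card {1..n}))"
      unfolding bad_def using n that by (intro prob_card_ge_le_exp[OF A(1)]) auto
    also have "\<dots> = exp (-4 * L)"
      using m2 n by simp
    \<comment> \<open>The weaker bound \<delta>/6 suffices: \<delta>/4 for each of four events adds
      up to \<delta>.\<close>
    also have "\<dots> \<le> exp (- L)"
      using L by simp
    also have "\<dots> = \<delta> / 6"
      using \<open>0 < \<delta>\<close> by (simp add: L_def exp_minus)
    finally show ?thesis
      using \<open>0 < \<delta>\<close> by simp
  qed
  \<comment> \<open>By symmetry a half-line receives half of the mass at distance more than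
    \<open>t\<close>. The sum is therefore \<open>h\<close> minus half of the total mass within
    distance \<open>t\<close>.\<close>
  have tails: "(\<Sum>i=1..n. prob {\<omega>\<in>space M. X i \<omega> \<in> B}) \<le> real h - d"
    if B: "B = {..<\<mu> - t} \<or> B = {\<mu> + t<..}" and "0 \<le> t"
      and d: "2 * d \<le> (\<Sum>i=1..n. 1 - prob {\<omega>\<in>space M. t < \<bar>X i \<omega> - \<mu>\<bar>})" for B t d
  proof -
    have "prob {\<omega>\<in>space M. X i \<omega> \<in> B} = prob {\<omega>\<in>space M. t < \<bar>X i \<omega> - \<mu>\<bar>} / 2"
      if "i \<in> {1..n}" for i
      using B symmetric_tails[OF rv[OF that] A(4)[OF that] \<open>0 \<le> t\<close>] by auto
    then have "(\<Sum>i=1..n. prob {\<omega>\<in>space M. X i \<omega> \<in> B})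
        = (\<Sum>i=1..n. prob {\<omega>\<in>space M. t < \<bar>X i \<omega> - \<mu>\<bar>}) / 2"
      unfolding sum_divide_distrib by (rule sum.cong[OF refl])
    with d show ?thesis
      by (simp add: h sum_subtractf)
  qed

  have bad_tail: "prob (bad B (real h - d + real m)) \<le> \<delta> / 4"
    if "B = {..<\<mu> - t} \<or> B = {\<mu> + t<..}" "0 \<le> t"
      "2 * d \<le> (\<Sum>i=1..n. 1 - prob {\<omega>\<in>space M. t < \<bar>X i \<omega> - \<mu>\<bar>})" for B t d
    using that(1) by (intro bad[OF _ tails[OF that]]) auto

  \<comment> \<open>The four exceptional events\<close>
  let ?lo = "order_stat n X (n div 2 - m)" and ?hi = "order_stat n X (n div 2 + m)"
  have rank: "1 \<le> n div 2 - m" "n div 2 - m \<le> n" "1 \<le> n div 2 + m" "n div 2 + m \<le> n"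
    using mn m h by auto
  let ?E = "{\<omega>\<in>space M. ?lo \<omega> \<le> \<mu> \<and> \<mu> \<le> ?hi \<omega> \<and> ?hi \<omega> - ?lo \<omega> \<le> 2 * s}"
  note [measurable] = borel_measurable_order_stat[OF rank(1,2) rv]
    borel_measurable_order_stat[OF rank(3,4) rv]
  define B1 where "B1 = bad {..<\<mu>} (real h + real m)"
  define B2 where "B2 = bad {\<mu><..} (real h + real m)"
  define B3 where "B3 = bad {..<\<mu> - s} (real h - real m)"
  define B4 where "B4 = bad {\<mu> + s<..} (real h - real m)"
  have [measurable]: "B1 \<in> events" "B2 \<in> events" "B3 \<in> events" "B4 \<in> events"
    unfolding B1_def B2_def B3_def B4_def by (intro bad_meas; simp)+
  have nonneg: "0 \<le> (\<Sum>i=1..n. 1 - prob {\<omega>\<in>space M. t < \<bar>X i \<omega> - \<mu>\<bar>})" for t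
    by (intro sum_nonneg) simp
  \<comment> \<open>Taking \<open>t = 0\<close> and \<open>d = 0\<close> puts the threshold at h +
    m.\<close>
  have p1: "prob B1 \<le> \<delta> / 4" and p2: "prob B2 \<le> \<delta> / 4"
    using bad_tail[OF disjI1[OF refl], of 0 0] bad_tail[OF disjI2[OF refl], of 0 0] nonneg[of 0]
    by (simp_all add: B1_def B2_def)
  \<comment> \<open>Taking \<open>t = s\<close> and \<open>d = 2 * m\<close>, which
    \<open>mean\<close> permits, puts the threshold at h - 2m + m = h - m.\<close>
  have p3: "prob B3 \<le> \<delta> / 4" and p4: "prob B4 \<le> \<delta> / 4"
    using bad_tail[OF disjI1[OF refl], of s "2 * real m"]
      bad_tail[OF disjI2[OF refl], of s "2 * real m"] mean s
    by (simp_all add: B3_def B4_def)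
  have "prob (B1 \<union> B2 \<union> B3 \<union> B4) \<le> prob B1 + prob B2 + prob B3 + prob B4"
    using measure_Un_le[of B1 M B2] measure_Un_le[of "B1 \<union> B2" M B3]
      measure_Un_le[of "B1 \<union> B2 \<union> B3" M B4] by simp
  then have p: "prob (B1 \<union> B2 \<union> B3 \<union> B4) \<le> \<delta>"
    using p1 p2 p3 p4 by linarith

  \<comment> \<open>From counts back to the median interval\<close>
  have count_compl: "card {i\<in>{1..n}. X i \<omega> \<le> x} + card {i\<in>{1..n}. X i \<omega> > x} = n" for \<omega> x
  proof -
    have "card {i\<in>{1..n}. X i \<omega> \<le> x} + card {i\<in>{1..n}. X i \<omega> > x}
        = card ({i\<in>{1..n}. X i \<omega> \<le> x} \<union> {i\<in>{1..n}. X i \<omega> > x})"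
      by (intro card_Un_disjoint[symmetric]) auto
    also have "{i\<in>{1..n}. X i \<omega> \<le> x} \<union> {i\<in>{1..n}. X i \<omega> > x} = {1..n}"
      by auto
    finally show ?thesis by simp
  qed
  have good: "space M - (B1 \<union> B2 \<union> B3 \<union> B4) \<subseteq> ?E"
  proof
    fix \<omega> assume \<omega>: "\<omega> \<in> space M - (B1 \<union> B2 \<union> B3 \<union> B4)"
    have le_iff: "order_stat n X k \<omega> \<le> x \<longleftrightarrow> k \<le> card {i\<in>{1..n}. X i \<omega> \<le> x}"
      and less_iff: "order_stat n X k \<omega> < x \<longleftrightarrow> k \<le> card {i\<in>{1..n}. X i \<omega> < x}"
      if "1 \<le> k" "k \<le> n" for k x
      using order_stat_downward_closed_iff[OF that, of "\<lambda>y. y \<le> x" X \<omega>]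
        order_stat_downward_closed_iff[OF that, of "\<lambda>y. y < x" X \<omega>] by auto
    have cnt: "card {i\<in>{1..n}. X i \<omega> < \<mu>} < h + m" "card {i\<in>{1..n}. X i \<omega> > \<mu>} < h + m"
      "card {i\<in>{1..n}. X i \<omega> < \<mu> - s} < h - m" "card {i\<in>{1..n}. X i \<omega> > \<mu> + s} < h - m"
      using \<omega> unfolding B1_def B2_def B3_def B4_def bad_def by auto
    \<comment> \<open>As n = 2h, fewer than h + m values above \<open>\<mu>\<close> leave more than
      h - m at or below it.\<close>
    have "?lo \<omega> \<le> \<mu>"
      using cnt(2) count_compl[of \<omega> \<mu>] h by (subst le_iff[OF rank(1,2)]) linarith
    moreover have "\<mu> \<le> ?hi \<omega>"
      using cnt(1) h less_iff[OF rank(3,4), of \<mu>] by auto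
    moreover have "\<mu> - s \<le> ?lo \<omega>"
      using cnt(3) h less_iff[OF rank(1,2), of "\<mu> - s"] by auto
    \<comment> \<open>Likewise, fewer than h - m values above \<open>\<mu> + s\<close> leave more
      than h + m at or below it.\<close>
    moreover have "?hi \<omega> \<le> \<mu> + s"
      using cnt(4) count_compl[of \<omega> "\<mu> + s"] h by (subst le_iff[OF rank(3,4)]) linarith
    ultimately show "\<omega> \<in> ?E"
      using \<omega> by simp
  qed
  have "1 - \<delta> \<le> prob (space M - (B1 \<union> B2 \<union> B3 \<union> B4))"
    using p by (subst prob_compl) auto
  also have "\<dots> \<le> prob ?E"
    using good by (intro finite_measure_mono) auto
  \<comment> \<open>Membership of \<open>\<mu>\<close> makes the interval nonempty, so its Lebesgue
    measure is the difference of its endpoints.\<close>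
  also have "?E = {\<omega> \<in> space M.
           \<mu> \<in> median_interval n X m \<omega> \<and>
           measure lborel (median_interval n X m \<omega>) \<le>
             8 * exp 1 * sqrt 2 * max (ln (3 / \<delta>)) (ln (real n + 1)) * inverse \<beta> * a}"
    unfolding median_interval_def s_def c_def by (auto simp: algebra_simps)
  finally show ?thesis
    unfolding a_def .
qed

end
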